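(* Let $n$ be a positive integer, let $c,d\in\{1,\ldots,n\}$, and let $m,s$ be positive integers. If $c\leq d$ and $s\cdot c\leq m\cdot d$, then $$I^{(m)}(n,c)\subset I^{(s)}(n,d).$$
   Context: Let $\mathbb{K}$ be an arbitrary field and $S(n)=\mathbb{K}[x_0,\ldots,x_n]$. Let $H_i=\{x_i=0\}\subset\mathbb{P}^n$ for $i=0,\ldots,n$. For $c\in\{1,\ldots,n\}$, $I(n,c)\subset S(n)$ denotes the ideal of the union (with reduced structure) of all $c$-fold intersections $H_{i_1}\cap\cdots\cap H_{i_c}$ with $i_1,\ldots,i_c\in\{0,\ldots,n\}$ pairwise distinct; that is, $I(n,c)$ is the intersection of the prime ideals $\langle x_{i_1},\ldots,x_{i_c}\rangle$ over all such choices of indices. For a homogeneous ideal $I\subseteq S(n)$ and a positive integer $m$, the $m$-th symbolic power is $I^{(m)}=S(n)\cap\bigcap_{Q\in\mathrm{Ass}(I)}I^m_Q$, where $I^m_Q$ is the localization of $I^m$ at $Q$ and the intersection takes place in the field of fractions of $S(n)$. Notation: $I^{(m)}(n,c)=(I(n,c))^{(m)}$. *)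

theory Defs
  imports
    "HOL-Library.Poly_Mapping"
    "HOL-Computational_Algebra.Fraction_Field"
    "HOL-Algebra.Ideal_Product"
begin

text \<open>
  Multivariate polynomials are finitely supported maps from monomials to coefficients; a monomial
  is in turn a finitely supported map from the variable indices to the exponents. The type
  \<open>'k mpol\<close> has the countably many variables \<open>x\<^sub>0, x\<^sub>1, \<dots>\<close>;
  the ring \<open>S(n) = K[x\<^sub>0, \<dots>, x\<^sub>n]\<close> is carved out as a carrier set.
\<close>

type_synonym 'k mpol = "(nat \<Rightarrow>\<^sub>0 nat) \<Rightarrow>\<^sub>0 'k"

definition var :: "nat \<Rightarrow> 'k::field mpol"
  where "var i = Poly_Mapping.single (Poly_Mapping.single i 1) 1"

definition S :: "nat \<Rightarrow> 'k::field mpol ring"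
  where "S n =
    \<lparr> carrier = {p. \<forall>t\<in>Poly_Mapping.keys p. Poly_Mapping.keys t \<subseteq> {0..n}},
      monoid.mult = (*), one = 1, zero = 0, add = (+) \<rparr>"

lemma domain_S: "domain (S n :: 'k::field mpol ring)"
proof -
  have "cring (S n :: 'k mpol ring)"
  proof (rule cringI)
    show "abelian_group (S n :: 'k mpol ring)"
    proof (rule abelian_groupI)
      fix p q :: "'k mpol"
      assume "p \<in> carrier (S n)" "q \<in> carrier (S n)"
      then show "p \<oplus>\<^bsub>S n\<^esub> q \<in> carrier (S n)"
        using keys_add[of p q] by (auto simp: S_def)
    next
      fix p :: "'k mpol"
      assume "p \<in> carrier (S n)"
      then have "- p \<in> carrier (S n)" "- p \<oplus>\<^bsub>S n\<^esub> p = \<zero>\<^bsub>S n\<^esub>"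
        by (auto simp: S_def)
      then show "\<exists>q\<in>carrier (S n). q \<oplus>\<^bsub>S n\<^esub> p = \<zero>\<^bsub>S n\<^esub>"
        by blast
    qed (auto simp: S_def algebra_simps)
    show "Group.comm_monoid (S n :: 'k mpol ring)"
    proof (rule comm_monoidI)
      fix p q :: "'k mpol"
      assume *: "p \<in> carrier (S n)" "q \<in> carrier (S n)"
      have "Poly_Mapping.keys t \<subseteq> {0..n}" if "t \<in> Poly_Mapping.keys (p * q)" for t
      proof -
        from keys_mult[of p q] that obtain u v
          where "t = u + v" "u \<in> Poly_Mapping.keys p" "v \<in> Poly_Mapping.keys q" by blast
        with * keys_add[of u v] show ?thesis by (fastforce simp: S_def)
      qed
      then show "p \<otimes>\<^bsub>S n\<^esub> q \<in> carrier (S n)"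
        by (simp add: S_def)
    qed (auto simp: S_def algebra_simps)
  qed (auto simp: S_def algebra_simps)
  then show ?thesis
    by (rule domain.intro) (auto intro!: domain_axioms.intro simp: S_def)
qed

lemma var_in_S: "var i \<in> carrier (S n) \<longleftrightarrow> i \<le> n"
  by (simp add: var_def S_def)

text \<open>
  The ideal \<open>I(n,c)\<close> of the union of all \<open>c\<close>-fold intersections of the coordinate hyperplanes.
\<close>

definition star_ideal :: "nat \<Rightarrow> nat \<Rightarrow> 'k::field mpol set"
  where "star_ideal n c = (\<Inter>A\<in>{A. A \<subseteq> {0..n} \<and> card A = c}. Idl\<^bsub>S n\<^esub> (var ` A))"

definition associated_primes :: "('a, 'b) ring_scheme \<Rightarrow> 'a set \<Rightarrow> 'a set set"
  where "associated_primes R I =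
    {Q. primeideal Q R \<and> (\<exists>f\<in>carrier R. Q = {g \<in> carrier R. g \<otimes>\<^bsub>R\<^esub> f \<in> I})}"

text \<open>
  The localization \<open>J\<^sub>Q\<close> as a subset of the field of fractions of \<open>S(n)\<close>. The latter is viewed
  inside the fraction field of the polynomial ring in all the variables: it is the subfield of
  the fractions with numerator and denominator in \<open>S(n)\<close>.
\<close>

definition localize :: "nat \<Rightarrow> 'k::field mpol set \<Rightarrow> 'k mpol set \<Rightarrow> 'k mpol fract set"
  where "localize n J Q = {Fraction_Field.Fract a b | a b. a \<in> J \<and> b \<in> carrier (S n) - Q}"

text \<open>
  The power \<open>I\<^sup>m\<close> of ideals is taken in the multiplicative monoid of ideals of \<open>S(n)\<close>.
\<close>

definition symbolic_power :: "nat \<Rightarrow> 'k::field mpol set \<Rightarrow> nat \<Rightarrow> 'k mpol set"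
  where "symbolic_power n I m =
    {f \<in> carrier (S n).
      Fraction_Field.Fract f 1 \<in>
        (\<Inter>Q\<in>associated_primes (S n) I. localize n (I [^]\<^bsub>ideals_set (S n)\<^esub> m) Q)}"

end

theory Submission
  imports Defs
begin

text \<open>
  Both symbolic powers are spanned by monomials: \<open>I\<^sup>(\<^sup>m\<^sup>)(n,c)\<close> consists of the polynomials all of
  whose monomials have degree at least \<open>m\<close> in any \<open>c\<close> of the variables. One inclusion holds because
  the order of vanishing along a coordinate subspace is additive on products and every prime
  \<open>\<langle>x\<^sub>i | i \<in> A\<rangle>\<close> with \<open>|A| = c\<close> is associated to \<open>I(n,c)\<close>; the other because each associated prime
  avoids the product \<open>b\<close> of the variables outside some such \<open>A\<close>, while \<open>x\<^sub>i b \<in> I(n,c)\<close> for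
  \<open>i \<in> A\<close>. The containment then reduces to averaging degrees over the \<open>c\<close>-subsets of a \<open>d\<close>-set.
\<close>

section \<open>Weights of monomials\<close>

text \<open>Passing to the parts of lowest weight excludes cancellation: the product of the two
  initial forms is nonzero because polynomials form a domain, and every other contribution to
  \<open>p * q\<close> has strictly larger weight.\<close>

lemma keys_mult_weight_le:
  fixes p q :: "'k::field mpol" and w :: "(nat \<Rightarrow>\<^sub>0 nat) \<Rightarrow> nat"
  assumes add: "\<And>u v. w (u + v) = w u + w v"
    and u: "u \<in> Poly_Mapping.keys p" and v: "v \<in> Poly_Mapping.keys q"
  obtains t where "t \<in> Poly_Mapping.keys (p * q)" "w t \<le> w u + w v"
proof -
  \<comment> \<open>The initial form \<open>f\<close> keeps all monomials of minimal weight
    \<open>a\<close> together, since the contribution of a single one of them to the product might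
    cancel against that of another of equal weight.\<close>
  have initial: "\<exists>a f g. p = f + g \<and> f \<noteq> 0 \<and> a \<le> w u \<and> (\<forall>t\<in>Poly_Mapping.keys f. w t = a)
      \<and> (\<forall>t\<in>Poly_Mapping.keys g. a < w t)"
    if u: "u \<in> Poly_Mapping.keys p" for u and p :: "'k mpol"
  proof -
    define a where "a = Min (w ` Poly_Mapping.keys p)"
    define f where "f = Poly_Mapping.mapp (\<lambda>t x. x when w t = a) p"
    have lookup_f: "Poly_Mapping.lookup f t = (Poly_Mapping.lookup p t when w t = a)" for t
      by (auto simp: f_def lookup_mapp when_def in_keys_iff)
    have a_le: "a \<le> w t" if "t \<in> Poly_Mapping.keys p" for t
      using that by (simp add: a_def)
    have "a \<in> w ` Poly_Mapping.keys p"
      unfolding a_def using u by (intro Min_in) auto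
    then obtain t where t: "t \<in> Poly_Mapping.keys p" "w t = a"
      by auto
    then have "f \<noteq> 0"
      using lookup_f[of t] by (auto simp: in_keys_iff)
    moreover have "w t = a" if "t \<in> Poly_Mapping.keys f" for t
      using that by (auto simp: in_keys_iff lookup_f when_def split: if_splits)
    moreover have "a < w t" if "t \<in> Poly_Mapping.keys (p - f)" for t
      using that a_le[of t]
      by (auto simp: in_keys_iff lookup_minus lookup_f when_def less_le split: if_splits)
    ultimately show ?thesis
      using a_le[OF u] by (intro exI[of _ a] exI[of _ f] exI[of _ "p - f"]) auto
  qed
  obtain a f g where p: "p = f + g" "f \<noteq> 0" "a \<le> w u"
      "\<And>t. t \<in> Poly_Mapping.keys f \<Longrightarrow> w t = a" "\<And>t. t \<in> Poly_Mapping.keys g \<Longrightarrow> a < w t"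
    using initial[OF u] by blast
  obtain b h k where q: "q = h + k" "h \<noteq> 0" "b \<le> w v"
      "\<And>t. t \<in> Poly_Mapping.keys h \<Longrightarrow> w t = b" "\<And>t. t \<in> Poly_Mapping.keys k \<Longrightarrow> b < w t"
    using initial[OF v] by blast
  have weight_q: "b \<le> w t" if "t \<in> Poly_Mapping.keys q" for t
    using that q keys_add[of h k] by (fastforce intro: less_imp_le)
  from p(2) q(2) obtain t where t: "t \<in> Poly_Mapping.keys (f * h)"
    by (metis all_not_in_conv keys_eq_empty mult_eq_0_iff)
  then have wt: "w t = a + b"
    using keys_mult[of f h] p(4) q(4) by (auto simp: add)
  \<comment> \<open>In the decomposition \<open>f * h + (f * k + g * q)\<close> the bracket lives in
    weights above \<open>a + b\<close>, so the coefficient of \<open>p * q\<close> at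
    \<open>t\<close> is that of \<open>f * h\<close>.\<close>
  have "t \<notin> Poly_Mapping.keys (f * k)"
    using keys_mult[of f k] p(4) q(5) wt by (fastforce simp: add)
  moreover have "t \<notin> Poly_Mapping.keys (g * q)"
    using keys_mult[of g q] p(5) weight_q wt by (fastforce simp: add)
  moreover have "p * q = f * h + (f * k + g * q)"
    by (simp add: p(1) q(1) algebra_simps)
  ultimately have "t \<in> Poly_Mapping.keys (p * q)"
    using t by (simp add: in_keys_iff lookup_add)
  moreover have "w t \<le> w u + w v"
    using wt p(3) q(3) by simp
  ultimately show ?thesis
    by (rule that)
qed

text \<open>For finite \<open>A\<close> this is the order of vanishing of the monomial with exponent
  vector \<open>t\<close> along the coordinate subspace where all \<open>x_i\<close>,
  \<open>i\<close> in \<open>A\<close>, vanish.\<close>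

definition degree_in :: "nat set \<Rightarrow> (nat \<Rightarrow>\<^sub>0 nat) \<Rightarrow> nat"
  where "degree_in A t = (\<Sum>i\<in>A. Poly_Mapping.lookup t i)"

lemma degree_in_zero [simp]: "degree_in A 0 = 0"
  by (simp add: degree_in_def)

lemma degree_in_add: "degree_in A (u + v) = degree_in A u + degree_in A v"
  by (simp add: degree_in_def lookup_add sum.distrib)

lemma degree_in_single:
  "finite A \<Longrightarrow> degree_in A (Poly_Mapping.single i k) = (if i \<in> A then k else 0)"
  by (simp add: degree_in_def lookup_single when_def)

lemma degree_in_sum: "degree_in A (sum f X) = (\<Sum>x\<in>X. degree_in A (f x))"
  by (induction X rule: infinite_finite_induct) (auto simp: degree_in_add)

lemma poly_mapping_split_single:
  fixes t :: "nat \<Rightarrow>\<^sub>0 nat"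
  assumes "Poly_Mapping.lookup t i > 0"
  obtains u where "t = u + Poly_Mapping.single i 1"
    "Poly_Mapping.keys u \<subseteq> Poly_Mapping.keys t"
proof
  show "t = (t - Poly_Mapping.single i 1) + Poly_Mapping.single i 1"
    using assms by (intro poly_mapping_eqI) (auto simp: lookup_add lookup_minus lookup_single when_def)
  show "Poly_Mapping.keys (t - Poly_Mapping.single i 1) \<subseteq> Poly_Mapping.keys t"
    by (auto simp: in_keys_iff lookup_minus)
qed

text \<open>Induction on the excess \<open>k\<close> of the size of \<open>D\<close> over
  \<open>c\<close>: the bound holds for \<open>D\<close> with any one point removed, and summing
  over the removed points averages these bounds. The multiplied-out form avoids division.\<close>

lemma degree_in_average:
  assumes "card D = c + k" "finite D"
    and "\<And>A. A \<subseteq> D \<Longrightarrow> card A = c \<Longrightarrow> m \<le> degree_in A t"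
  shows "m * (c + k) \<le> c * degree_in D t"
  using assms
proof (induction k arbitrary: D)
  case 0
  then show ?case
    by simp
next
  case (Suc k)
  define N where "N = c + k"
  have card_D: "card D = Suc N"
    using Suc.prems by (simp add: N_def)
  have "m * N \<le> c * degree_in (D - {i}) t" if "i \<in> D" for i
    unfolding N_def using Suc.prems that by (intro Suc.IH) auto
  then have "(\<Sum>i\<in>D. m * N) \<le> (\<Sum>i\<in>D. c * degree_in (D - {i}) t)"
    by (rule sum_mono)
  \<comment> \<open>Each index of \<open>D\<close> survives in all but one of the sets
    \<open>D - {i}\<close>. Restoring the missing exponent to every summand gives
    \<open>Suc N\<close> copies of the full degree.\<close>
  also have "(\<Sum>i\<in>D. degree_in (D - {i}) t) = N * degree_in D t"
  proof -
    have "(\<Sum>i\<in>D. degree_in (D - {i}) t) + degree_in D t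
        = (\<Sum>i\<in>D. degree_in (D - {i}) t + Poly_Mapping.lookup t i)"
      by (simp add: sum.distrib degree_in_def)
    also have "\<dots> = (\<Sum>i\<in>D. degree_in D t)"
      using Suc.prems(2) by (intro sum.cong) (auto simp: degree_in_def sum.remove[of D])
    also have "\<dots> = Suc N * degree_in D t"
      by (simp add: card_D)
    finally show ?thesis
      by simp
  qed
  then have "(\<Sum>i\<in>D. c * degree_in (D - {i}) t) = N * (c * degree_in D t)"
    by (simp add: sum_distrib_left[symmetric])
  finally have *: "N * (m * Suc N) \<le> N * (c * degree_in D t)"
    by (simp add: card_D algebra_simps)
  \<comment> \<open>The factor \<open>N\<close> cancels only when positive. If \<open>N = 0\<close>,
    then \<open>c = 0\<close>, so the empty set is an admissible \<open>A\<close> and forces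
    \<open>m = 0\<close>.\<close>
  show ?case
  proof (cases "N = 0")
    case True
    then have "m \<le> degree_in {} t"
      using Suc.prems(3)[of "{}"] by (simp add: N_def)
    with True show ?thesis
      by (simp add: degree_in_def)
  next
    case False
    with * have "m * Suc N \<le> c * degree_in D t"
      by (simp only: mult_le_cancel1)
    then show ?thesis
      by (simp add: N_def)
  qed
qed

section \<open>The ideals of the coordinate subspaces\<close>

lemma S_simps [simp]:
  "mult (S n) = (*)" "add (S n) = (+)" "one (S n) = 1" "zero (S n) = 0"
  by (simp_all add: S_def)

lemma S_cring: "cring (S n :: 'k::field mpol ring)"
  using domain_S domain.axioms(1) by blast

lemma S_ring: "ring (S n :: 'k::field mpol ring)"
  using S_cring cring.axioms(1) by blast

lemma in_carrier_S:
  "p \<in> carrier (S n) \<longleftrightarrow> (\<forall>t\<in>Poly_Mapping.keys p. Poly_Mapping.keys t \<subseteq> {0..n})"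
  by (simp add: S_def)

lemma S_mult_closed: "p \<in> carrier (S n) \<Longrightarrow> q \<in> carrier (S n) \<Longrightarrow> p * q \<in> carrier (S n)"
  using monoid.m_closed[OF ring.is_monoid[OF S_ring], of p n q] by simp

lemma S_one_closed: "1 \<in> carrier (S n)"
  by (simp add: in_carrier_S)

lemma idealI_S:
  fixes J :: "'k::field mpol set"
  assumes "J \<subseteq> carrier (S n)" "0 \<in> J"
    and add: "\<And>p q. p \<in> J \<Longrightarrow> q \<in> J \<Longrightarrow> p + q \<in> J"
    and mult: "\<And>p q. p \<in> J \<Longrightarrow> q \<in> carrier (S n) \<Longrightarrow> q * p \<in> J"
  shows "ideal J (S n)"
proof (rule idealI[OF S_ring])
  \<comment> \<open>Closure under negation comes from multiplication by \<open>- 1\<close>, an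
    element of \<open>S n\<close>.\<close>
  have minus: "- p \<in> J" if "p \<in> J" for p
    using mult[OF that, of "- 1"] by (simp add: in_carrier_S)
  interpret ring "S n :: 'k mpol ring"
    by (rule S_ring)
  show "subgroup J (add_monoid (S n))"
  proof (rule add.subgroupI)
    fix p
    assume p: "p \<in> J"
    have "\<ominus>\<^bsub>S n\<^esub> p = - p"
      using p minus[OF p] assms(1) by (intro minus_equality) auto
    with minus[OF p] show "\<ominus>\<^bsub>S n\<^esub> p \<in> J"
      by simp
  qed (use assms in auto)
qed (use mult in \<open>auto simp: mult.commute\<close>)

lemma ideal_S_props:
  assumes "ideal J (S n)"
  shows "J \<subseteq> carrier (S n)" "0 \<in> J" "\<And>p q. p \<in> J \<Longrightarrow> q \<in> J \<Longrightarrow> p + q \<in> J"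
    "\<And>p q. p \<in> J \<Longrightarrow> q \<in> carrier (S n) \<Longrightarrow> q * p \<in> J"
proof -
  interpret ideal J "S n"
    by (rule assms)
  show "J \<subseteq> carrier (S n)" "0 \<in> J" "\<And>p q. p \<in> J \<Longrightarrow> q \<in> J \<Longrightarrow> p + q \<in> J"
    "\<And>p q. p \<in> J \<Longrightarrow> q \<in> carrier (S n) \<Longrightarrow> q * p \<in> J"
    using a_subset additive_subgroup.zero_closed[OF is_additive_subgroup]
      additive_subgroup.a_closed[OF is_additive_subgroup] I_l_closed by auto
qed

lemma ideal_S_sum:
  assumes "ideal J (S n)" "\<And>x. x \<in> X \<Longrightarrow> f x \<in> J"
  shows "sum f X \<in> J"
  using assms(2) ideal_S_props[OF assms(1)]
  by (induction X rule: infinite_finite_induct) auto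

lemma sum_monomials:
  fixes p :: "'a \<Rightarrow>\<^sub>0 'b::comm_monoid_add"
  shows "(\<Sum>t\<in>Poly_Mapping.keys p. Poly_Mapping.single t (Poly_Mapping.lookup p t)) = p"
  by (intro poly_mapping_eqI) (auto simp: lookup_sum lookup_single when_def in_keys_iff)

text \<open>For \<open>A\<close> inside \<open>{0..n}\<close> this is the \<open>m\<close>-th power
  of the prime generated by the \<open>x_i\<close> with \<open>i\<close> in \<open>A\<close>,
  encoded by a condition on monomials so that membership can be tested term by term.\<close>

definition order_ideal :: "nat \<Rightarrow> nat set \<Rightarrow> nat \<Rightarrow> 'k::field mpol set"
  where "order_ideal n A m =
    {p \<in> carrier (S n). \<forall>t\<in>Poly_Mapping.keys p. m \<le> degree_in A t}"

lemma order_ideal_mult: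
  assumes "p \<in> order_ideal n A a" "q \<in> order_ideal n A b"
  shows "p * q \<in> order_ideal n A (a + b)"
  unfolding order_ideal_def
proof (intro CollectI conjI ballI)
  show "p * q \<in> carrier (S n)"
    using assms by (auto simp: order_ideal_def intro: S_mult_closed)
  fix t
  assume "t \<in> Poly_Mapping.keys (p * q)"
  then obtain u v where "t = u + v" "u \<in> Poly_Mapping.keys p" "v \<in> Poly_Mapping.keys q"
    using keys_mult[of p q] by blast
  then show "a + b \<le> degree_in A t"
    using assms by (auto simp: order_ideal_def degree_in_add intro: add_mono)
qed

lemma order_ideal_zero: "order_ideal n A 0 = carrier (S n)"
  by (auto simp: order_ideal_def)

lemma ideal_order_ideal: "ideal (order_ideal n A m :: 'k::field mpol set) (S n)"
proof (rule idealI_S)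
  fix p q :: "'k mpol"
  assume *: "p \<in> order_ideal n A m" "q \<in> order_ideal n A m"
  then have "p \<oplus>\<^bsub>S n\<^esub> q \<in> carrier (S n)"
    by (intro ring.ring_simprules(1)[OF S_ring]) (auto simp: order_ideal_def)
  with * show "p + q \<in> order_ideal n A m"
    using keys_add[of p q] by (auto simp: order_ideal_def)
next
  fix p q :: "'k mpol"
  assume "p \<in> order_ideal n A m" "q \<in> carrier (S n)"
  then show "q * p \<in> order_ideal n A m"
    using order_ideal_mult[of q n A 0 p m] by (simp add: order_ideal_zero)
qed (auto simp: order_ideal_def in_carrier_S)

text \<open>The order of vanishing along a coordinate subspace is not raised by units of the local ring.\<close>

lemma order_ideal_cancel:
  assumes "p * q \<in> order_ideal n A m" "p \<in> carrier (S n)" "q \<in> carrier (S n)"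
    "q \<notin> order_ideal n A 1"
  shows "p \<in> order_ideal n A m"
proof -
  \<comment> \<open>A monomial \<open>v\<close> of \<open>q\<close> free of the variables in
    \<open>A\<close> adds nothing to the weight, so each monomial \<open>u\<close> of
    \<open>p\<close> is matched by one of \<open>p * q\<close> of no larger degree in
    \<open>A\<close>.\<close>
  obtain v where v: "v \<in> Poly_Mapping.keys q" "degree_in A v = 0"
    using assms(3,4) by (auto simp: order_ideal_def not_le)
  have "m \<le> degree_in A u" if u: "u \<in> Poly_Mapping.keys p" for u
  proof -
    obtain t where "t \<in> Poly_Mapping.keys (p * q)" "degree_in A t \<le> degree_in A u + degree_in A v"
      using keys_mult_weight_le[OF degree_in_add u v(1)] .
    with v(2) assms(1) show ?thesis
      by (fastforce simp: order_ideal_def)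
  qed
  with assms(2) show ?thesis
    by (simp add: order_ideal_def)
qed

text \<open>Primality is the case \<open>m = 1\<close> of cancellation: a product in the ideal with
  one factor outside has its other factor inside.\<close>

lemma primeideal_order_ideal: "primeideal (order_ideal n A 1 :: 'k::field mpol set) (S n)"
proof (rule primeidealI[OF ideal_order_ideal S_cring])
  have "(1 :: 'k mpol) \<notin> order_ideal n A 1"
    by (simp add: order_ideal_def)
  then show "carrier (S n :: 'k mpol ring) \<noteq> order_ideal n A 1"
    using S_one_closed by blast
qed (use order_ideal_cancel in auto)

text \<open>A monomial of positive degree in \<open>A\<close> is divisible by some
  \<open>x_i\<close> with \<open>i\<close> in \<open>A\<close>, and a polynomial is the sum of its
  terms.\<close>

lemma Idl_var_eq_order_ideal:
  assumes "A \<subseteq> {0..n}"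
  shows "Idl\<^bsub>S n\<^esub> (var ` A) = (order_ideal n A 1 :: 'k::field mpol set)"
proof
  have fin: "finite A"
    using assms finite_subset by blast
  have vars: "(var ` A :: 'k mpol set) \<subseteq> carrier (S n)"
    using assms by (auto simp: var_in_S)
  then show "Idl\<^bsub>S n\<^esub> (var ` A) \<subseteq> (order_ideal n A 1 :: 'k mpol set)"
    by (intro ring.genideal_minimal[OF S_ring] ideal_order_ideal)
      (auto simp: order_ideal_def var_def degree_in_single[OF fin])
  have J: "ideal (Idl\<^bsub>S n\<^esub> (var ` A :: 'k mpol set)) (S n)"
    by (rule ring.genideal_ideal[OF S_ring vars])
  show "order_ideal n A 1 \<subseteq> (Idl\<^bsub>S n\<^esub> (var ` A) :: 'k mpol set)"
  proof
    fix p :: "'k mpol"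
    assume p: "p \<in> order_ideal n A 1"
    have "Poly_Mapping.single t (Poly_Mapping.lookup p t) \<in> Idl\<^bsub>S n\<^esub> (var ` A)"
      if t: "t \<in> Poly_Mapping.keys p" for t
    proof -
      have "degree_in A t \<noteq> 0"
        using p t by (force simp: order_ideal_def)
      then obtain i where i: "i \<in> A" "Poly_Mapping.lookup t i > 0"
        by (auto simp: degree_in_def fin)
      then obtain u where u: "t = u + Poly_Mapping.single i 1"
          "Poly_Mapping.keys u \<subseteq> Poly_Mapping.keys t"
        using poly_mapping_split_single by blast
      have "var i \<in> Idl\<^bsub>S n\<^esub> (var ` A :: 'k mpol set)"
        using ring.genideal_self[OF S_ring vars] i by auto
      moreover have "Poly_Mapping.single u (Poly_Mapping.lookup p t) \<in> carrier (S n)"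
        using p t u(2) by (auto simp: order_ideal_def in_carrier_S)
      ultimately have "Poly_Mapping.single u (Poly_Mapping.lookup p t) * var i \<in> Idl\<^bsub>S n\<^esub> (var ` A)"
        by (rule ideal_S_props(4)[OF J])
      moreover have "Poly_Mapping.single u (Poly_Mapping.lookup p t) * var i
          = Poly_Mapping.single t (Poly_Mapping.lookup p t)"
        by (subst (2) u(1)) (simp add: var_def mult_single)
      ultimately show ?thesis
        by simp
    qed
    then show "p \<in> Idl\<^bsub>S n\<^esub> (var ` A)"
      using ideal_S_sum[OF J, of "Poly_Mapping.keys p"] sum_monomials[of p] by metis
  qed
qed

section \<open>The star ideals and their symbolic powers\<close>

lemma star_ideal_eq:
  "star_ideal n c = (\<Inter>A\<in>{A. A \<subseteq> {0..n} \<and> card A = c}. (order_ideal n A 1 :: 'k::field mpol set))"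
  unfolding star_ideal_def by (intro INF_cong) (auto simp: Idl_var_eq_order_ideal)

text \<open>The bound on \<open>c\<close> provides at least one \<open>c\<close>-subset; an empty
  intersection would be the whole type rather than an ideal of \<open>S n\<close>.\<close>

lemma ideal_star_ideal:
  assumes "c \<le> n"
  shows "ideal (star_ideal n c :: 'k::field mpol set) (S n)"
proof -
  have "{A. A \<subseteq> {0..n} \<and> card A = c} \<noteq> {}"
    using assms obtain_subset_with_card_n[of c "{0..n}"] by auto
  then show ?thesis
    unfolding star_ideal_eq
    by (intro ring.i_Intersect[OF S_ring]) (auto simp: ideal_order_ideal)
qed

section \<open>Powers of ideals and the order of vanishing of their elements\<close>

lemma ideals_set_simps:
  "one (ideals_set R) = carrier R" "mult (ideals_set R) = ideal_prod R"
  by (simp_all add: ideals_set_def)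

lemma ideal_ideal_power:
  assumes "ideal I (S n)"
  shows "ideal (I [^]\<^bsub>ideals_set (S n)\<^esub> (m::nat)) (S n)"
proof (induction m)
  case 0
  show ?case
    by (simp add: ideals_set_simps ring.oneideal[OF S_ring])
next
  case (Suc m)
  then show ?case
    using assms ring.ideal_prod_is_ideal[OF S_ring] by (simp add: ideals_set_simps)
qed

lemma ideal_power_subset_order_ideal:
  assumes "I \<subseteq> order_ideal n A 1"
  shows "I [^]\<^bsub>ideals_set (S n)\<^esub> (m::nat) \<subseteq> order_ideal n A m"
proof (induction m)
  case 0
  show ?case
    by (simp add: ideals_set_simps order_ideal_zero)
next
  case (Suc m)
  show ?case
  proof
    fix p
    assume "p \<in> I [^]\<^bsub>ideals_set (S n)\<^esub> Suc m"
    then have "p \<in> ideal_prod (S n) (I [^]\<^bsub>ideals_set (S n)\<^esub> m) I"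
      by (simp add: ideals_set_simps)
    then show "p \<in> order_ideal n A (Suc m)"
    proof induction
      case (prod i j)
      then show ?case
        using Suc assms order_ideal_mult[of i n A m j 1] by auto
    next
      case (sum p q)
      then show ?case
        using ideal_S_props(3)[OF ideal_order_ideal] by simp
    qed
  qed
qed

text \<open>Exponent vector of the product of the variables outside \<open>A\<close>. Among the
  primes of the subsets of \<open>{0..n}\<close> of the same size as \<open>A\<close>, exactly the
  one of \<open>A\<close> does not contain this product.\<close>

definition complement_monomial :: "nat \<Rightarrow> nat set \<Rightarrow> nat \<Rightarrow>\<^sub>0 nat"
  where "complement_monomial n A = (\<Sum>i\<in>{0..n} - A. Poly_Mapping.single i 1)"

lemma keys_complement_monomial: "Poly_Mapping.keys (complement_monomial n A) \<subseteq> {0..n}"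
  by (auto simp: complement_monomial_def in_keys_iff lookup_sum lookup_single when_def split: if_splits)

lemma degree_in_complement_monomial:
  assumes "B \<subseteq> {0..n}"
  shows "degree_in B (complement_monomial n A) = card (B - A)"
proof -
  have "finite B"
    using assms finite_subset by blast
  then have "degree_in B (complement_monomial n A)
      = (\<Sum>i\<in>{0..n} - A. if i \<in> B then Suc 0 else 0)"
    by (simp add: complement_monomial_def degree_in_sum degree_in_single)
  also have "\<dots> = card (({0..n} - A) \<inter> B)"
    by (simp add: sum.If_cases)
  also have "({0..n} - A) \<inter> B = B - A"
    using assms by auto
  finally show ?thesis .
qed

abbreviation complement_poly :: "nat \<Rightarrow> nat set \<Rightarrow> 'k::field mpol"
  where "complement_poly n A \<equiv> Poly_Mapping.single (complement_monomial n A) 1"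

lemma complement_poly_in_S [simp]: "complement_poly n A \<in> carrier (S n)"
  using keys_complement_monomial by (auto simp: in_carrier_S)

lemma complement_poly_notin:
  "A \<subseteq> {0..n} \<Longrightarrow> complement_poly n A \<notin> order_ideal n A 1"
  by (simp add: order_ideal_def degree_in_complement_monomial)

lemma mult_complement_poly_in_star_ideal:
  fixes p :: "'k::field mpol"
  assumes A: "A \<subseteq> {0..n}" "card A = c" and p: "p \<in> order_ideal n A 1"
  shows "p * complement_poly n A \<in> star_ideal n c"
  unfolding star_ideal_eq
proof (intro INT_I)
  fix B
  assume "B \<in> {B. B \<subseteq> {0..n} \<and> card B = c}"
  then have B: "B \<subseteq> {0..n}" "card B = c"
    by auto
  show "p * complement_poly n A \<in> order_ideal n B 1"
  proof (cases "B = A")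
    case True
    then show ?thesis
      using order_ideal_mult[OF p, of "complement_poly n A" 0]
      by (simp add: order_ideal_zero)
  next
    case False
    have "finite A" "finite B"
      using A(1) B(1) finite_subset by blast+
    \<comment> \<open>Distinct finite sets of equal size are not nested, so \<open>B\<close>
      contains an index outside \<open>A\<close>, whose variable divides the complementary
      product.\<close>
    then have "\<not> B \<subseteq> A"
      using False A(2) B(2) card_subset_eq by metis
    then have "card (B - A) \<ge> 1"
      using \<open>finite B\<close> by (simp add: Suc_le_eq card_gt_0_iff)
    then have "complement_poly n A \<in> (order_ideal n B 1 :: 'k mpol set)"
      using complement_poly_in_S by (simp add: order_ideal_def degree_in_complement_monomial[OF B(1)])
    moreover have "p \<in> order_ideal n B 0"
      using p by (auto simp: order_ideal_def)
    ultimately show ?thesis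
      using order_ideal_mult[of p n B 0] by simp
  qed
qed

text \<open>The witness is \<open>complement_poly n A\<close>: multiplying by it sends the prime of
  \<open>A\<close> into the star ideal, and since it lies outside that prime, cancellation gives the
  converse.\<close>

lemma order_ideal_associated:
  assumes A: "A \<subseteq> {0..n}" "card A = c"
  shows "(order_ideal n A 1 :: 'k::field mpol set) \<in> associated_primes (S n) (star_ideal n c)"
proof -
  have "g \<in> order_ideal n A 1"
    if "g \<in> carrier (S n)" "g * complement_poly n A \<in> star_ideal n c" for g :: "'k mpol"
  proof (rule order_ideal_cancel)
    show "g * complement_poly n A \<in> order_ideal n A 1"
      using that(2) A by (auto simp: star_ideal_eq)
  qed (use that(1) complement_poly_notin[OF A(1)] in simp_all)
  moreover have "g \<in> carrier (S n)" if "g \<in> order_ideal n A 1" for g :: "'k mpol"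
    using that by (simp add: order_ideal_def)
  ultimately have "order_ideal n A 1
      = {g \<in> carrier (S n). g * complement_poly n A \<in> (star_ideal n c :: 'k mpol set)}"
    using mult_complement_poly_in_star_ideal[OF A] by blast
  then show ?thesis
    unfolding associated_primes_def
    by (intro CollectI conjI primeideal_order_ideal bexI[of _ "complement_poly n A"]) simp_all
qed

text \<open>If \<open>Q\<close> is the colon ideal of the star ideal by \<open>f\<close>, then
  \<open>Q\<close> being proper puts \<open>f\<close> outside some prime of a \<open>c\<close>-set
  \<open>A\<close>, and cancelling \<open>f\<close> there confines \<open>Q\<close> to that prime.
  An inclusion is enough, since elements outside the larger prime are denominators for
  \<open>Q\<close>.\<close>

lemma associated_prime_subset:
  fixes Q :: "'k::field mpol set"
  assumes "Q \<in> associated_primes (S n) (star_ideal n c)"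
  obtains A where "A \<subseteq> {0..n}" "card A = c" "Q \<subseteq> order_ideal n A 1"
proof -
  obtain f where f: "f \<in> carrier (S n)" "Q = {g \<in> carrier (S n). g * f \<in> star_ideal n c}"
    and prime: "primeideal Q (S n)"
    using assms by (auto simp: associated_primes_def)
  have "Q \<subseteq> carrier (S n)" "Q \<noteq> carrier (S n)"
    using f(2) primeideal.I_notcarr[OF prime] by auto
  moreover have "f \<notin> star_ideal n c"
  proof
    assume "f \<in> star_ideal n c"
    moreover have "h * f \<in> order_ideal n A 1" if "f \<in> order_ideal n A 1" "h \<in> carrier (S n)"
      for h A
      using ideal_S_props(4)[OF ideal_order_ideal] that by blast
    ultimately have "Q = carrier (S n)"
      by (auto simp: f(2) star_ideal_eq)
    then show False
      using \<open>Q \<noteq> carrier (S n)\<close> by simp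
  qed
  then obtain A where A: "A \<subseteq> {0..n}" "card A = c" "f \<notin> order_ideal n A 1"
    by (auto simp: star_ideal_eq)
  moreover have "g \<in> order_ideal n A 1" if "g \<in> Q" for g
  proof -
    have "g * f \<in> order_ideal n A 1" "g \<in> carrier (S n)"
      using that A by (auto simp: f(2) star_ideal_eq)
    then show ?thesis
      using order_ideal_cancel f(1) A(3) by blast
  qed
  ultimately show ?thesis
    using that by blast
qed

text \<open>Induction on \<open>s\<close>: one variable from \<open>A\<close> is split off
  \<open>t\<close> and paired with one copy of \<open>complement_poly n A\<close>. Each such pair
  lies in the star ideal and supplies one factor of the power.\<close>

lemma monomial_mult_complement_poly_power:
  fixes a :: "'k::field"
  assumes A: "A \<subseteq> {0..n}" "card A = c" and "c \<le> n"
    and "Poly_Mapping.keys t \<subseteq> {0..n}" "s \<le> degree_in A t"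
  shows "Poly_Mapping.single t a * complement_poly n A ^ s
      \<in> star_ideal n c [^]\<^bsub>ideals_set (S n)\<^esub> s"
  using assms(4,5)
proof (induction s arbitrary: t)
  case 0
  then show ?case
    by (simp add: ideals_set_simps in_carrier_S)
next
  case (Suc s)
  have fin: "finite A"
    using A(1) finite_subset by blast
  have "degree_in A t \<noteq> 0"
    using Suc.prems by linarith
  then obtain i where i: "i \<in> A" "Poly_Mapping.lookup t i > 0"
    by (auto simp: degree_in_def fin)
  then obtain u where u: "t = u + Poly_Mapping.single i 1"
      "Poly_Mapping.keys u \<subseteq> Poly_Mapping.keys t"
    using poly_mapping_split_single by blast
  have "s \<le> degree_in A u"
    using Suc.prems(2) i(1) by (simp add: u(1) degree_in_add degree_in_single[OF fin])
  then have "Poly_Mapping.single u a * complement_poly n A ^ s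
      \<in> star_ideal n c [^]\<^bsub>ideals_set (S n)\<^esub> s"
    using Suc u(2) by auto
  moreover have "(var i :: 'k mpol) \<in> order_ideal n A 1"
    using i A(1) by (auto simp: order_ideal_def var_in_S) (simp add: var_def degree_in_single[OF fin])
  then have "var i * complement_poly n A \<in> (star_ideal n c :: 'k mpol set)"
    by (rule mult_complement_poly_in_star_ideal[OF A])
  ultimately have "(Poly_Mapping.single u a * complement_poly n A ^ s) * (var i * complement_poly n A)
      \<in> star_ideal n c [^]\<^bsub>ideals_set (S n)\<^esub> Suc s"
    using ideal_prod.prod[of _ _ _ _ "S n"] by (simp add: ideals_set_simps)
  moreover have "Poly_Mapping.single t a = Poly_Mapping.single u a * var i"
    by (simp add: u(1) var_def mult_single)
  ultimately show ?case
    by (simp add: mult_ac)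
qed

lemma order_ideal_mult_complement_poly_power:
  fixes p :: "'k::field mpol"
  assumes A: "A \<subseteq> {0..n}" "card A = c" and "c \<le> n" and p: "p \<in> order_ideal n A s"
  shows "p * complement_poly n A ^ s \<in> star_ideal n c [^]\<^bsub>ideals_set (S n)\<^esub> s"
proof -
  have "(\<Sum>t\<in>Poly_Mapping.keys p.
      Poly_Mapping.single t (Poly_Mapping.lookup p t) * complement_poly n A ^ s)
      \<in> star_ideal n c [^]\<^bsub>ideals_set (S n)\<^esub> s"
    using p by (intro ideal_S_sum[OF ideal_ideal_power[OF ideal_star_ideal[OF \<open>c \<le> n\<close>]]]
        monomial_mult_complement_poly_power[OF A \<open>c \<le> n\<close>])
      (auto simp: order_ideal_def in_carrier_S)
  then show ?thesis
    by (simp add: sum_distrib_right[symmetric] sum_monomials)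
qed

text \<open>Makes the powers of \<open>complement_poly n A\<close> available as denominators;
  primality passes from one factor to all powers.\<close>

lemma complement_poly_power_notin:
  assumes "A \<subseteq> {0..n}"
  shows "complement_poly n A ^ s \<in> carrier (S n) - (order_ideal n A 1 :: 'k::field mpol set)"
proof (induction s)
  case 0
  then show ?case
    by (simp add: S_one_closed) (simp add: order_ideal_def)
next
  case (Suc s)
  then show ?case
    using primeideal.I_prime[OF primeideal_order_ideal, of "complement_poly n A" n
        "complement_poly n A ^ s :: 'k mpol" A]
      complement_poly_notin[OF assms]
    by (auto intro: S_mult_closed)
qed

lemma symbolic_power_star_ideal:
  assumes "c \<le> n"
  shows "symbolic_power n (star_ideal n c :: 'k::field mpol set) m =
    {f \<in> carrier (S n). \<forall>A. A \<subseteq> {0..n} \<longrightarrow> card A = c \<longrightarrow> f \<in> order_ideal n A m}"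
proof (intro equalityI subsetI CollectI conjI allI impI)
  fix f :: "'k mpol" and A
  assume f: "f \<in> symbolic_power n (star_ideal n c) m"
  then show fS: "f \<in> carrier (S n)"
    by (simp add: symbolic_power_def)
  assume A: "A \<subseteq> {0..n}" "card A = c"
  have "Fraction_Field.Fract f 1
      \<in> localize n (star_ideal n c [^]\<^bsub>ideals_set (S n)\<^esub> m) (order_ideal n A 1)"
    using f order_ideal_associated[OF A] by (auto simp: symbolic_power_def)
  then obtain a b where ab: "Fraction_Field.Fract f 1 = Fraction_Field.Fract a b"
      "a \<in> star_ideal n c [^]\<^bsub>ideals_set (S n)\<^esub> m" "b \<in> carrier (S n)" "b \<notin> order_ideal n A 1"
    by (auto simp: localize_def)
  \<comment> \<open>Nonzero denominators turn equality of fractions into \<open>f * b = a\<close>.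
    The order of \<open>a\<close> is at least \<open>m\<close>, and cancelling \<open>b\<close>,
    which lies outside the prime, transfers this bound to \<open>f\<close>.\<close>
  have "b \<noteq> 0"
    using ab(4) ideal_S_props(2)[OF ideal_order_ideal] by blast
  then have "f * b = a"
    using ab(1) by (simp add: eq_fract)
  moreover have "star_ideal n c \<subseteq> (order_ideal n A 1 :: 'k mpol set)"
    using A by (auto simp: star_ideal_eq)
  then have "a \<in> order_ideal n A m"
    using ab(2) ideal_power_subset_order_ideal by blast
  ultimately show "f \<in> order_ideal n A m"
    using order_ideal_cancel fS ab(3,4) by blast
next
  fix f :: "'k mpol"
  assume f: "f \<in> {f \<in> carrier (S n). \<forall>A. A \<subseteq> {0..n} \<longrightarrow> card A = c \<longrightarrow> f \<in> order_ideal n A m}"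
  have "Fraction_Field.Fract f 1 \<in> localize n (star_ideal n c [^]\<^bsub>ideals_set (S n)\<^esub> m) Q"
    if Q: "Q \<in> associated_primes (S n) (star_ideal n c)" for Q
  proof -
    obtain A where A: "A \<subseteq> {0..n}" "card A = c" "Q \<subseteq> order_ideal n A 1"
      using associated_prime_subset[OF Q] .
    \<comment> \<open>This denominator lies outside the prime of \<open>A\<close>, hence outside
      \<open>Q\<close>, and its \<open>m\<close> factors carry \<open>f\<close> into the
      \<open>m\<close>-th ordinary power.\<close>
    define b :: "'k mpol" where "b = complement_poly n A ^ m"
    have b: "b \<in> carrier (S n)" "b \<notin> order_ideal n A 1"
      using complement_poly_power_notin[OF A(1)] by (auto simp: b_def)
    then have "b \<noteq> 0"
      using ideal_S_props(2)[OF ideal_order_ideal] by blast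
    then have "Fraction_Field.Fract f 1 = Fraction_Field.Fract (f * b) b"
      by (simp add: eq_fract)
    moreover have "f * b \<in> star_ideal n c [^]\<^bsub>ideals_set (S n)\<^esub> m"
      unfolding b_def using f A(1,2)
      by (intro order_ideal_mult_complement_poly_power[OF A(1,2) assms]) auto
    ultimately show ?thesis
      using b A(3) by (auto simp: localize_def)
  qed
  then show "f \<in> symbolic_power n (star_ideal n c) m"
    using f by (simp add: symbolic_power_def)
qed

theorem theoremB:
  fixes n c d m s :: nat
  assumes "n > 0"
    and "c \<in> {1..n}" and "d \<in> {1..n}"
    and "m > 0" and "s > 0"
    and "c \<le> d" and "s * c \<le> m * d"
  shows "symbolic_power n (star_ideal n c :: 'k::field mpol set) m
           \<subseteq> symbolic_power n (star_ideal n d) s"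
proof
  fix f :: "'k mpol"
  assume "f \<in> symbolic_power n (star_ideal n c) m"
  then have fS: "f \<in> carrier (S n)"
    and f: "\<And>A. A \<subseteq> {0..n} \<Longrightarrow> card A = c \<Longrightarrow> f \<in> order_ideal n A m"
    using assms(2) by (auto simp: symbolic_power_star_ideal)
  have "s \<le> degree_in D t"
    if D: "D \<subseteq> {0..n}" "card D = d" and t: "t \<in> Poly_Mapping.keys f" for D t
  proof -
    have "m \<le> degree_in A t" if "A \<subseteq> D" "card A = c" for A
      using f[of A] that D(1) t by (auto simp: order_ideal_def)
    moreover have "finite D"
      using D(1) finite_subset by blast
    \<comment> \<open>The averaging lemma is applied with \<open>k = d - c\<close>, so that
      \<open>c + k = d\<close> by \<open>c \<le> d\<close>. Together with
      \<open>s * c \<le> m * d\<close> it bounds \<open>s * c\<close>, and the positive factor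
      \<open>c\<close> then cancels.\<close>
    ultimately have "m * (c + (d - c)) \<le> c * degree_in D t"
      using D(2) assms(6) by (intro degree_in_average) auto
    then have "s * c \<le> degree_in D t * c"
      using assms(6,7) by (simp only: le_add_diff_inverse mult.commute[of c "degree_in D t"])
    then show ?thesis
      using assms(2) by simp
  qed
  then have "f \<in> order_ideal n D s" if "D \<subseteq> {0..n}" "card D = d" for D
    using that fS by (simp add: order_ideal_def)
  with fS show "f \<in> symbolic_power n (star_ideal n d) s"
    using assms(3) by (auto simp: symbolic_power_star_ideal)
qed

end
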